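(* Consider a single-query quantum algorithm on $n$ qubits, with unitaries $V,W$ and initial state $|\psi_0\rangle$, for an oracle classification problem $(\mathcal F,\{A_j\}_{j\in\mathcal J},\{U_f\},\{p_f\})$. Let $\rho_{JY}=\sum_{j\in\mathcal J}p_j|j\rangle\langle j|\otimes\sigma_j$ be the joint state of the oracle class and the computer just before the final measurement, and let $Y$ be the outcome of measuring the computer in the computational basis. Then the non-optimized quantum discord of $\rho_{JY}$ with respect to the computational-basis measurement of subsystem $Y$ satisfies $$D_Y(\rho_{JY};Z^{\otimes n})=\chi-I(J;Y),\qquad \chi=S(\rho_Y)-\sum_{j\in\mathcal J}p_jS(\sigma_j).$$
   Context: Oracle classification problem: a finite set $\mathcal F$; a partition $\mathcal F=\bigsqcup_{j\in\mathcal J}A_j$ into nonempty classes; a unitary $U_f$ on $m\le n$ qubits for each $f$ (acting as $U_f\otimes I$ on $n$ qubits); and a probability distribution $p_f=\Pr(F=f)$. $J$ is the class of $F$; $p_j=\sum_{f\in A_j}p_f$, assumed positive. With $T_f=W(U_f\otimes I)V$, $$\sigma_j=\frac1{p_j}\sum_{f\in A_j}p_fT_f|\psi_0\rangle\langle\psi_0|T_f^\dagger,\qquad \rho_Y=\sum_jp_j\sigma_j,\qquad \rho_J=\sum_jp_j|j\rangle\langle j|,$$ where $\{|j\rangle\}_{j\in\mathcal J}$ is an orthonormal basis of $\mathbb C^{\mathcal J}$. The outcome $Y\in\{0,1\}^n$ satisfies $\Pr(Y=y\mid J=j)=\langle y|\sigma_j|y\rangle$. $S$ is von Neumann entropy and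 $I(J;Y)$ is Shannon mutual information, with logarithms in base 2. The non-optimized discord with respect to the computational-basis measurement $\{|y\rangle\langle y|\}_{y\in\{0,1\}^n}$ is $$D_Y(\rho_{JY};Z^{\otimes n})=S(\rho_Y)-S(\rho_{JY})+S(\rho_J|Z^{\otimes n}),\qquad S(\rho_J|Z^{\otimes n})=\sum_{y}\Pr(Y=y)\,S(\rho_J^{y}),$$ where $\rho_J^y$ is the normalized state of subsystem $J$ conditioned on outcome $y$ (terms of zero probability omitted). *)

theory Defs
  imports "HOL-Probability.Information" "Jordan_Normal_Form.Char_Poly"
    "Jordan_Normal_Form.Schur_Decomposition"
begin

text \<open>The computational basis vector of n qubits labelled by a bit string y is
  \<^term>\<open>unit_vec (2 ^ n) k :: complex vec\<close>, where \<open>k < 2 ^ n\<close> has the binary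
  expansion y, first qubit most significant.\<close>

definition mtrace :: "complex mat \<Rightarrow> complex" where
  "mtrace R = (\<Sum>i<dim_row R. R $$ (i, i))"

definition unitary_mat :: "nat \<Rightarrow> complex mat \<Rightarrow> bool" where
  "unitary_mat d U \<longleftrightarrow> U \<in> carrier_mat d d \<and>
     mat_adjoint U * U = 1\<^sub>m d \<and> U * mat_adjoint U = 1\<^sub>m d"

definition ketbra :: "complex vec \<Rightarrow> complex mat" where
  "ketbra v = mat (dim_vec v) (dim_vec v) (\<lambda>(i, k). vec_index v i * cnj (vec_index v k))"

text \<open>The library's matrix type has no zero element independent of the dimension, hence
  no instance of \<^const>\<open>sum\<close>.\<close>

definition mat_sum :: "nat \<Rightarrow> ('i \<Rightarrow> complex mat) \<Rightarrow> 'i set \<Rightarrow> complex mat" where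
  "mat_sum d R I = mat d d (\<lambda>ik. \<Sum>x\<in>I. R x $$ ik)"

definition kron :: "complex mat \<Rightarrow> complex mat \<Rightarrow> complex mat" where
  "kron R Q = mat (dim_row R * dim_row Q) (dim_col R * dim_col Q)
     (\<lambda>(i, k). R $$ (i div dim_row Q, k div dim_col Q) * Q $$ (i mod dim_row Q, k mod dim_col Q))"

text \<open>Partial traces of an operator on the tensor product of spaces of dimensions a and b,
  over the first and over the second factor.\<close>

definition ptrace_fst :: "nat \<Rightarrow> nat \<Rightarrow> complex mat \<Rightarrow> complex mat" where
  "ptrace_fst a b R = mat b b (\<lambda>(y, z). \<Sum>i<a. R $$ (i * b + y, i * b + z))"

definition ptrace_snd :: "nat \<Rightarrow> nat \<Rightarrow> complex mat \<Rightarrow> complex mat" where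
  "ptrace_snd a b R = mat a a (\<lambda>(i, k). \<Sum>y<b. R $$ (i * b + y, k * b + y))"

text \<open>Eigenvalues counted with multiplicity, logarithm in base 2. Since
  \<^term>\<open>ln 0 = (0::real)\<close>, the eigenvalue 0 contributes nothing. The definition is
  meant for positive semidefinite matrices; lemma \<open>vn_entropy_spectral\<close> below
  identifies it with minus the trace of \<open>\<rho> log \<rho>\<close>, the logarithm being taken by
  functional calculus.\<close>

definition vn_entropy :: "complex mat \<Rightarrow> real" where
  "vn_entropy \<rho> = - (\<Sum>x\<in>#proots (char_poly \<rho>). Re x * log 2 (Re x))"

text \<open>Measurement of the second factor of a bipartite state in its computational basis:
  projector, outcome probability, and normalized conditional state of the first factor.\<close>

definition proj_snd :: "nat \<Rightarrow> nat \<Rightarrow> nat \<Rightarrow> complex mat" where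
  "proj_snd a b y = kron (1\<^sub>m a) (ketbra (unit_vec b y))"

definition outcome_prob :: "nat \<Rightarrow> nat \<Rightarrow> complex mat \<Rightarrow> nat \<Rightarrow> real" where
  "outcome_prob a b \<rho> y = Re (mtrace (proj_snd a b y * \<rho> * proj_snd a b y))"

definition cond_state :: "nat \<Rightarrow> nat \<Rightarrow> complex mat \<Rightarrow> nat \<Rightarrow> complex mat" where
  "cond_state a b \<rho> y = complex_of_real (1 / outcome_prob a b \<rho> y) \<cdot>\<^sub>m
     ptrace_snd a b (proj_snd a b y * \<rho> * proj_snd a b y)"

definition cond_entropy :: "nat \<Rightarrow> nat \<Rightarrow> complex mat \<Rightarrow> real" where
  "cond_entropy a b \<rho> = (\<Sum>y | y < b \<and> outcome_prob a b \<rho> y \<noteq> 0.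
     outcome_prob a b \<rho> y * vn_entropy (cond_state a b \<rho> y))"

definition discord_comp :: "nat \<Rightarrow> nat \<Rightarrow> complex mat \<Rightarrow> real" where
  "discord_comp a b \<rho> = vn_entropy (ptrace_fst a b \<rho>) - vn_entropy \<rho> + cond_entropy a b \<rho>"

definition query_op ::
  "nat \<Rightarrow> nat \<Rightarrow> complex mat \<Rightarrow> complex mat \<Rightarrow> complex mat \<Rightarrow> complex mat" where
  "query_op n m V W U = W * kron U (1\<^sub>m (2 ^ (n - m))) * V"

definition class_state ::
  "nat \<Rightarrow> ('f \<Rightarrow> real) \<Rightarrow> ('f \<Rightarrow> complex mat) \<Rightarrow> complex vec \<Rightarrow> 'f set \<Rightarrow> complex mat" where
  "class_state n p T \<psi> C = complex_of_real (1 / (\<Sum>f\<in>C. p f)) \<cdot>\<^sub>m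
     mat_sum (2 ^ n) (\<lambda>f. complex_of_real (p f) \<cdot>\<^sub>m (T f * ketbra \<psi> * mat_adjoint (T f))) C"

lemma mtrace_comm:
  assumes "A \<in> carrier_mat d e" "B \<in> carrier_mat e d"
  shows "mtrace (A * B) = mtrace (B * A)"
proof -
  have "mtrace (A * B) = (\<Sum>i<d. \<Sum>k<e. A $$ (i, k) * B $$ (k, i))"
    using assms by (auto simp: mtrace_def scalar_prod_def lessThan_atLeast0 intro!: sum.cong)
  also have "\<dots> = (\<Sum>k<e. \<Sum>i<d. B $$ (k, i) * A $$ (i, k))"
    by (subst sum.swap) (simp add: mult.commute)
  also have "\<dots> = mtrace (B * A)"
    using assms by (auto simp: mtrace_def scalar_prod_def lessThan_atLeast0 intro!: sum.cong)
  finally show ?thesis .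
qed

lemma vn_entropy_spectral:
  fixes l :: "nat \<Rightarrow> real"
  assumes U: "unitary_mat d U"
    and \<rho>: "\<rho> = U * mat_diag d (\<lambda>i. complex_of_real (l i)) * mat_adjoint U"
  shows "vn_entropy \<rho> = - Re (mtrace
     (\<rho> * (U * mat_diag d (\<lambda>i. complex_of_real (log 2 (l i))) * mat_adjoint U)))"
proof -
  let ?D = "mat_diag d (\<lambda>i. complex_of_real (l i))"
  let ?L = "mat_diag d (\<lambda>i. complex_of_real (log 2 (l i)))"
  have c: "U \<in> carrier_mat d d" "mat_adjoint U \<in> carrier_mat d d"
    "?D \<in> carrier_mat d d" "?L \<in> carrier_mat d d"
    using U by (auto simp: unitary_mat_def mat_adjoint_def)
  have UU: "mat_adjoint U * U = 1\<^sub>m d" "U * mat_adjoint U = 1\<^sub>m d"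
    using U by (auto simp: unitary_mat_def)
  have "similar_mat \<rho> ?D"
    unfolding similar_mat_def similar_mat_wit_def Let_def
    using c UU \<rho> by (intro exI[of _ U] exI[of _ "mat_adjoint U"]) auto
  then have "char_poly \<rho> = char_poly ?D" by (rule char_poly_similar)
  also have "\<dots> = (\<Prod>a\<leftarrow>diag_mat ?D. [:- a, 1:])"
    by (rule char_poly_upper_triangular[OF c(3)]) (auto simp: mat_diag_def upper_triangular_def)
  also have "diag_mat ?D = map (\<lambda>i. complex_of_real (l i)) [0..<d]"
    by (auto simp: diag_mat_def mat_diag_def)
  also have "(\<Prod>a\<leftarrow>\<dots>. [:- a, 1:]) = (\<Prod>i=0..<d. [:- complex_of_real (l i), 1:])"
    by (induction d) (auto simp: atLeast0_lessThan_Suc mult.commute)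
  finally have "proots (char_poly \<rho>) = (\<Sum>i=0..<d. {#complex_of_real (l i)#})"
    by (simp add: proots_prod)
  also have "\<dots> = image_mset (\<lambda>i. complex_of_real (l i)) (mset_set {0..<d})"
    by (induction d) (auto simp: atLeast0_lessThan_Suc)
  finally have "vn_entropy \<rho> = - (\<Sum>i=0..<d. l i * log 2 (l i))"
    by (simp add: vn_entropy_def sum_unfold_sum_mset image_mset.compositionality o_def)
  moreover have "mtrace (\<rho> * (U * ?L * mat_adjoint U)) = mtrace (?D * ?L)"
  proof -
    have "\<rho> * (U * ?L * mat_adjoint U) = U * (?D * ((mat_adjoint U * U) * (?L * mat_adjoint U)))"
      unfolding \<rho> using c by (simp add: assoc_mult_mat[of _ d d _ d _ d] mult_carrier_mat[of _ d d _ d])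
    also have "\<dots> = U * ((?D * ?L) * mat_adjoint U)"
      using c by (simp add: UU assoc_mult_mat[of _ d d _ d _ d] mult_carrier_mat[of _ d d _ d] left_mult_one_mat[of _ d d] right_mult_one_mat[of _ d d] del: mat_diag_diag)
    also have "mtrace \<dots> = mtrace ((?D * ?L) * mat_adjoint U * U)"
      using c by (intro mtrace_comm[of _ d d] mult_carrier_mat[of _ d d _ d]) auto
    also have "(?D * ?L) * mat_adjoint U * U = ?D * ?L"
      using c by (simp add: UU assoc_mult_mat[of _ d d _ d _ d] mult_carrier_mat[of _ d d _ d] left_mult_one_mat[of _ d d] right_mult_one_mat[of _ d d] del: mat_diag_diag)
    finally show ?thesis .
  qed
  moreover have "mtrace (?D * ?L) = complex_of_real (\<Sum>i=0..<d. l i * log 2 (l i))"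
    unfolding mat_diag_diag by (simp add: mtrace_def mat_diag_def lessThan_atLeast0)
  ultimately show ?thesis by simp
qed

end

(*
  The states ketbra (ket j) live on mutually orthogonal lines, so the classical-quantum state is
  unitarily equivalent to a block diagonal matrix with blocks p_j sigma_j, and its spectrum is the
  union of theirs: S(rho_JY) = H(J) + sum_j p_j S(sigma_j).  Conditioned on the outcome y, the
  first subsystem is diagonal in the basis ket j with eigenvalues Pr(J = j | Y = y), hence
  S(rho_J | Z) = H(J | Y).  The identity is then I(J;Y) = H(J) - H(J | Y).

  The spectrum of a block is read off a Schur triangularisation rather than a diagonalisation, and
  since ln x = ln |x| in the library, the logarithm of a product splits for nonzero factors of any
  sign; so the entropy identities hold for arbitrary complex blocks.
*)
theory Submission
  imports Defs
begin

section \<open>Entropy read off a Schur triangular form\<close>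

lemma complex_schur:
  fixes A :: "complex mat"
  assumes "A \<in> carrier_mat d d"
  shows "\<exists>B P Q. similar_mat_wit A B P Q \<and> upper_triangular B"
proof -
  obtain es where "char_poly A = (\<Prod>e\<leftarrow>es. [:- e, 1:])"
    using char_poly_factorized[OF assms] by blast
  from schur_decomposition[OF assms this] show ?thesis
    by (cases "schur_decomposition A es") blast
qed

lemma proots_prod_list_linear:
  "proots (\<Prod>a\<leftarrow>as. [:- a, 1 :: complex:]) = mset as"
proof (induction as)
  case (Cons a as)
  have "(\<Prod>a\<leftarrow>as. [:- a, 1 :: complex:]) \<noteq> 0"
    by (auto simp: prod_list_zero_iff)
  then have "proots ([:- a, 1:] * (\<Prod>a\<leftarrow>as. [:- a, 1:])) = {#a#} + mset as"
    by (subst proots_mult) (auto simp: Cons.IH)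
  then show ?case by simp
qed simp

text \<open>Similar matrices share their characteristic polynomial, and that of a triangular matrix
  splits into linear factors over the diagonal. This makes Schur forms sufficient for all entropy
  computations below, with no Hermitian or positive \<open>A\<close> in sight.\<close>

lemma vn_entropy_triangular:
  assumes A: "similar_mat A B" and B: "B \<in> carrier_mat d d" "upper_triangular B"
  shows "vn_entropy A = - (\<Sum>i<d. Re (B $$ (i, i)) * log 2 (Re (B $$ (i, i))))"
proof -
  have "char_poly A = (\<Prod>a\<leftarrow>diag_mat B. [:- a, 1:])"
    using char_poly_similar[OF A] char_poly_upper_triangular[OF B] by simp
  then have "vn_entropy A = - (\<Sum>x\<in>#mset (diag_mat B). Re x * log 2 (Re x))"
    by (simp add: vn_entropy_def proots_prod_list_linear)
  also have "\<dots> = - (\<Sum>i\<leftarrow>[0..<d]. Re (B $$ (i, i)) * log 2 (Re (B $$ (i, i))))"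
    using B(1) by (simp add: diag_mat_def o_def flip: sum_mset_sum_list mset_map)
  finally show ?thesis
    by (simp add: interv_sum_list_conv_sum_set_nat atLeast0LessThan)
qed

text \<open>Each eigenvalue x turns into c * x, and log (c * x) splits as log c + log x; the log c
  parts add up to the trace. Eigenvalues with zero real part contribute nothing on either side. For
  a state of trace one and c = p this is p S - p log p, the source of the H(J) term in the joint
  entropy.\<close>

lemma vn_entropy_smult:
  assumes A: "A \<in> carrier_mat d d" and c: "c > 0"
  shows "vn_entropy (complex_of_real c \<cdot>\<^sub>m A)
    = c * vn_entropy A - c * log 2 c * Re (mtrace A)"
proof -
  obtain B P Q where wit: "similar_mat_wit A B P Q" and ut: "upper_triangular B"
    using complex_schur[OF A] by blast
  note w = similar_mat_witD2[OF A wit]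
  \<comment> \<open>Cyclicity of the trace together with \<open>Q * P = 1\<close> reduces the trace
    of \<open>A = P * B * Q\<close> to the diagonal sum of \<open>B\<close>.\<close>
  have "mtrace A = mtrace (B * Q * P)"
    unfolding w(3) using w by (subst mtrace_comm[of _ d d, symmetric])
      (auto simp: assoc_mult_mat[of _ d d _ d _ d])
  also have "B * Q * P = B"
    using w by (simp add: assoc_mult_mat[of _ d d _ d _ d])
  finally have tr: "mtrace A = (\<Sum>i<d. B $$ (i, i))"
    using w(5) by (simp add: mtrace_def)
  have "similar_mat (complex_of_real c \<cdot>\<^sub>m A) (complex_of_real c \<cdot>\<^sub>m B)"
    using similar_mat_wit_smult[OF wit] by (auto simp: similar_mat_def)
  then have "vn_entropy (complex_of_real c \<cdot>\<^sub>m A)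
    = - (\<Sum>i<d. (c * Re (B $$ (i, i))) * log 2 (c * Re (B $$ (i, i))))"
    using w(5) ut c by (subst vn_entropy_triangular[of _ "complex_of_real c \<cdot>\<^sub>m B" d])
      (auto simp: upper_triangular_def)
  also have "\<dots> = - (\<Sum>i<d. c * (Re (B $$ (i, i)) * log 2 (Re (B $$ (i, i)))) + c * log 2 c * Re (B $$ (i, i)))"
    using c by (intro arg_cong[of _ _ uminus] sum.cong refl) (auto simp: log_mult algebra_simps)
  also have "\<dots> = c * vn_entropy A - c * log 2 c * Re (mtrace A)"
    using wit w(5) ut
    by (subst vn_entropy_triangular[of A B d])
      (auto simp: similar_mat_def tr sum.distrib sum_distrib_left)
  finally show ?thesis .
qed

section \<open>Block coordinates on a tensor product and the entropy of a classical-quantum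
  sum\<close>

lemma sum_lessThan_mult_split:
  fixes g :: "nat \<Rightarrow> 'a::comm_monoid_add"
  shows "(\<Sum>r<a * b. g r) = (\<Sum>i<a. \<Sum>y<b. g (i * b + y))"
proof -
  have "(\<Sum>r\<in>{i * b..<i * b + b}. g r) = (\<Sum>y<b. g (i * b + y))" for i
    using sum.shift_bounds_nat_ivl[of g 0 "i * b" b]
    by (simp add: add.commute atLeast0LessThan)
  then show ?thesis by (simp flip: sum.nat_group)
qed

lemma mult_add_less:
  fixes i y a b :: nat
  assumes "i < a" "y < b"
  shows "i * b + y < a * b"
proof -
  have "i * b + y < Suc i * b" using assms by simp
  also have "\<dots> \<le> a * b" using assms by (intro mult_right_mono) auto
  finally show ?thesis .
qed

text \<open>Quotient and remainder by \<open>b\<close> turn every index below \<open>a * b\<close>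
  into a pair (position in the first factor, position in the second), which is how the entries of
  Kronecker products are organised.\<close>

lemma eq_mat_blockI:
  assumes "A \<in> carrier_mat (a * b) (a * b)" "B \<in> carrier_mat (a * b) (a * b)"
    and "\<And>i y k z. i < a \<Longrightarrow> y < b \<Longrightarrow> k < a \<Longrightarrow> z < b \<Longrightarrow>
      A $$ (i * b + y, k * b + z) = B $$ (i * b + y, k * b + z)"
  shows "A = B"
proof (rule eq_matI)
  fix s t assume "s < dim_row B" "t < dim_col B"
  then have st: "s < a * b" "t < a * b" using assms by auto
  then have "b > 0" by (cases b) auto
  then show "A $$ (s, t) = B $$ (s, t)"
    using assms(3)[of "s div b" "s mod b" "t div b" "t mod b"] st
    by (simp add: less_mult_imp_div_less)
qed (use assms in auto)

lemma mult_mat_index: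
  assumes "A \<in> carrier_mat d d" "B \<in> carrier_mat d d" "s < d" "t < d"
  shows "(A * B) $$ (s, t) = (\<Sum>r<d. A $$ (s, r) * B $$ (r, t))"
  using assms by (auto simp: scalar_prod_def atLeast0LessThan intro!: sum.cong)

lemma sum_cnj_conv_cscalar_prod:
  assumes "u \<in> carrier_vec d" "v \<in> carrier_vec d"
  shows "(\<Sum>i<d. u $ i * cnj (v $ i)) = u \<bullet>c (v :: complex vec)"
  using assms by (auto simp: scalar_prod_def atLeast0LessThan intro!: sum.cong)

text \<open>With Schur forms \<open>R (e k) = P k * B k * Q k\<close>, the sum is similar to the
  block diagonal matrix with blocks \<open>B k\<close>. That matrix is upper triangular, so its
  diagonal is the union of the diagonals of the blocks. The blocks are arbitrary, so probability
  weights can be absorbed into them.\<close>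

lemma vn_entropy_block:
  fixes ket :: "'i \<Rightarrow> complex vec"
  assumes fin: "finite I"
    and ket: "\<And>i. i \<in> I \<Longrightarrow> ket i \<in> carrier_vec (card I)"
      "\<And>i j. i \<in> I \<Longrightarrow> j \<in> I \<Longrightarrow> ket i \<bullet>c ket j = (if i = j then 1 else 0)"
    and R: "\<And>i. i \<in> I \<Longrightarrow> R i \<in> carrier_mat b b"
  shows "vn_entropy (mat_sum (card I * b) (\<lambda>i. kron (ketbra (ket i)) (R i)) I)
    = (\<Sum>i\<in>I. vn_entropy (R i))"
proof -
  define a where "a = card I"
  \<comment> \<open>An enumeration of the labels: \<open>e k\<close> is the label that owns the
    \<open>k\<close>-th diagonal block of \<open>T\<close>.\<close>
  obtain e where e: "bij_betw e {..<a} I"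
    using ex_bij_betw_nat_finite[OF fin] by (auto simp: a_def atLeast0LessThan)
  have eI: "e k \<in> I" if "k < a" for k using e that by (auto simp: bij_betw_def)
  have einj: "e k = e l \<longleftrightarrow> k = l" if "k < a" "l < a" for k l
    using e that by (auto simp: bij_betw_def inj_on_def)
  have "\<forall>k. \<exists>B P Q. k < a \<longrightarrow> similar_mat_wit (R (e k)) B P Q \<and> upper_triangular B"
    using complex_schur R eI by meson
  then obtain B P Q where
    wit: "\<And>k. k < a \<Longrightarrow> similar_mat_wit (R (e k)) (B k) (P k) (Q k)"
    and ut: "\<And>k. k < a \<Longrightarrow> upper_triangular (B k)" by metis
  note w = similar_mat_witD2[OF R[OF eI] wit]
  define v where "v k i = ket (e k) $ i" for k i
  have v: "(\<Sum>i<a. v k i * cnj (v l i)) = (if k = l then 1 else 0)" if "k < a" "l < a" for k l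
    unfolding v_def using that ket[OF eI] ket(2)[OF eI eI]
    by (subst sum_cnj_conv_cscalar_prod) (auto simp: a_def[symmetric] einj)
  \<comment> \<open>Column block \<open>k\<close> of \<open>S\<close> is \<open>ket (e k)\<close>
    tensored with \<open>P k\<close>; row block \<open>k\<close> of \<open>S'\<close> is the adjoint
    of \<open>ket (e k)\<close> tensored with \<open>Q k\<close>. So \<open>S\<close> combines the
    change to the ket basis with the Schur change of basis inside each block.\<close>
  define S where "S = mat (a * b) (a * b)
    (\<lambda>(s, t). v (t div b) (s div b) * P (t div b) $$ (s mod b, t mod b))"
  define S' where "S' = mat (a * b) (a * b)
    (\<lambda>(s, t). cnj (v (s div b) (t div b)) * Q (s div b) $$ (s mod b, t mod b))"
  define T where "T = mat (a * b) (a * b)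
    (\<lambda>(s, t). if s div b = t div b then B (s div b) $$ (s mod b, t mod b) else 0)"
  define \<rho> where "\<rho> = mat_sum (a * b) (\<lambda>i. kron (ketbra (ket i)) (R i)) I"
  have carr: "S \<in> carrier_mat (a * b) (a * b)" "S' \<in> carrier_mat (a * b) (a * b)"
    "T \<in> carrier_mat (a * b) (a * b)" "\<rho> \<in> carrier_mat (a * b) (a * b)"
    by (auto simp: S_def S'_def T_def \<rho>_def mat_sum_def)
  have S: "S $$ (i * b + y, k * b + z) = v k i * P k $$ (y, z)"
    and S': "S' $$ (i * b + y, k * b + z) = cnj (v i k) * Q i $$ (y, z)"
    and T: "T $$ (i * b + y, k * b + z) = (if i = k then B i $$ (y, z) else 0)"
    if "i < a" "y < b" "k < a" "z < b" for i y k z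
    using that by (auto simp: S_def S'_def T_def mult_add_less)
  have mult: "(X * Z) $$ (i * b + y, k * b + z)
      = (\<Sum>j<a. \<Sum>x<b. X $$ (i * b + y, j * b + x) * Z $$ (j * b + x, k * b + z))"
    if "X \<in> carrier_mat (a * b) (a * b)" "Z \<in> carrier_mat (a * b) (a * b)"
      "i < a" "y < b" "k < a" "z < b" for X Z i y k z
    using that by (subst mult_mat_index[of _ "a * b"]) (auto simp: mult_add_less sum_lessThan_mult_split)
  have \<rho>_ent: "\<rho> $$ (i * b + y, i' * b + z) = (\<Sum>k<a. v k i * cnj (v k i') * R (e k) $$ (y, z))"
    if "i < a" "y < b" "i' < a" "z < b" for i y i' z
  proof -
    have "\<rho> $$ (i * b + y, i' * b + z) = (\<Sum>j\<in>I. kron (ketbra (ket j)) (R j) $$ (i * b + y, i' * b + z))"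
      using that by (simp add: \<rho>_def mat_sum_def mult_add_less)
    also have "\<dots> = (\<Sum>k<a. kron (ketbra (ket (e k))) (R (e k)) $$ (i * b + y, i' * b + z))"
      by (rule sum.reindex_bij_betw[OF e, symmetric])
    also have "\<dots> = (\<Sum>k<a. v k i * cnj (v k i') * R (e k) $$ (y, z))"
      using that carrier_vecD[OF ket(1)[OF eI]] carrier_matD[OF R[OF eI]]
      by (auto simp: kron_def ketbra_def v_def mult_add_less a_def[symmetric] intro!: sum.cong)
    finally show ?thesis .
  qed
  \<comment> \<open>The sum factors into an inner product of kets, which vanishes between different
    blocks, and an entry of \<open>Q k * P l\<close>, which is the identity for k = l.\<close>
  have S'S: "S' * S = 1\<^sub>m (a * b)"
  proof (rule eq_mat_blockI[of _ a b])
    fix k x l z assume h: "k < a" "x < b" "l < a" "z < b"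
    have "(S' * S) $$ (k * b + x, l * b + z)
      = (\<Sum>i<a. \<Sum>u<b. cnj (v k i) * Q k $$ (x, u) * (v l i * P l $$ (u, z)))"
      using h by (subst mult[OF carr(2) carr(1)]) (simp_all add: S S')
    also have "\<dots> = (\<Sum>i<a. v l i * cnj (v k i)) * (\<Sum>u<b. Q k $$ (x, u) * P l $$ (u, z))"
      by (simp add: sum_product mult_ac)
    also have "\<dots> = (if k = l then 1 else 0) * (Q k * P l) $$ (x, z)"
      using v[of l k] mult_mat_index[OF w(7) w(6), of k l x z] h by simp
    also have "\<dots> = (if k = l \<and> x = z then 1 else 0)"
      using w(2) h by auto
    also have "\<dots> = 1\<^sub>m (a * b) $$ (k * b + x, l * b + z)"
    proof -
      have "k * b + x = l * b + z \<longleftrightarrow> k = l \<and> x = z"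
        using h by (metis add_right_cancel div_mult_self3 div_less less_nat_zero_code add_0 add_left_cancel)
      then show ?thesis using h by (simp add: mult_add_less)
    qed
    finally show "(S' * S) $$ (k * b + x, l * b + z) = 1\<^sub>m (a * b) $$ (k * b + x, l * b + z)" .
  qed (use carr in auto)
  have ST: "(S * T) $$ (i * b + y, k * b + z) = v k i * (P k * B k) $$ (y, z)"
    if h: "i < a" "y < b" "k < a" "z < b" for i y k z
  proof -
    have "(S * T) $$ (i * b + y, k * b + z)
      = (\<Sum>l<a. if l = k then v k i * (\<Sum>u<b. P k $$ (y, u) * B k $$ (u, z)) else 0)"
      unfolding mult[OF carr(1) carr(3) h] using h
      by (intro sum.cong refl) (auto simp: S T sum_distrib_left mult.assoc)
    then show ?thesis using h mult_mat_index[OF w(6) w(5), of k k y z] by simp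
  qed
  \<comment> \<open>Block \<open>k\<close> contributes the ket-bra of \<open>ket (e k)\<close>
    tensored with \<open>P k * B k * Q k\<close>, and the latter is \<open>R (e k)\<close>.\<close>
  have STS: "\<rho> = S * T * S'"
  proof (rule eq_mat_blockI[of _ a b])
    fix i y i' z assume h: "i < a" "y < b" "i' < a" "z < b"
    have "(S * T * S') $$ (i * b + y, i' * b + z)
      = (\<Sum>k<a. \<Sum>u<b. v k i * (P k * B k) $$ (y, u) * (cnj (v k i') * Q k $$ (u, z)))"
      using h by (subst mult[OF mult_carrier_mat[OF carr(1) carr(3)] carr(2)])
        (simp_all add: ST S' del: index_mult_mat)
    also have "\<dots> = (\<Sum>k<a. v k i * cnj (v k i') * (\<Sum>u<b. (P k * B k) $$ (y, u) * Q k $$ (u, z)))"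
      by (simp add: sum_distrib_left mult_ac)
    also have "\<dots> = (\<Sum>k<a. v k i * cnj (v k i') * (P k * B k * Q k) $$ (y, z))"
      using h mult_mat_index[OF mult_carrier_mat[OF w(6) w(5)] w(7)]
      by (intro sum.cong refl) simp
    also have "\<dots> = \<rho> $$ (i * b + y, i' * b + z)"
      using w(3) h by (auto simp: \<rho>_ent simp del: index_mult_mat)
    finally show "\<rho> $$ (i * b + y, i' * b + z) = (S * T * S') $$ (i * b + y, i' * b + z)" ..
  qed (use carr in auto)
  \<comment> \<open>\<open>S\<close> and \<open>S'\<close> are square, so the one-sided inverse is
    two-sided; completeness of the kets is thereby obtained without computing
    \<open>S * S'\<close>.\<close>
  have "similar_mat \<rho> T"
    unfolding similar_mat_def similar_mat_wit_def Let_def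
    using carr S'S STS mat_mult_left_right_inverse[OF carr(2) carr(1) S'S]
    by (intro exI[of _ S] exI[of _ S']) auto
  \<comment> \<open>A position below the diagonal lies either between two different blocks, where
    \<open>T\<close> is zero, or inside one block with its remainders in the same order, where
    \<open>B\<close> is zero.\<close>
  moreover have "upper_triangular T"
    unfolding upper_triangular_def
  proof (intro allI impI)
    fix s t assume st: "s < dim_row T" "t < s"
    then have s: "s < a * b" using carr by simp
    then have b: "b > 0" by (cases b) auto
    show "T $$ (s, t) = 0"
    proof (cases "s div b = t div b")
      case True
      then have "t mod b < s mod b"
        using st(2) by (metis div_mult_mod_eq nat_add_left_cancel_less)
      moreover have k: "t div b < a" using s st(2) by (simp add: less_mult_imp_div_less)
      ultimately show ?thesis
        using ut[OF k] w(5)[OF k] s st b True by (auto simp: T_def upper_triangular_def)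
    qed (use s st in \<open>simp add: T_def\<close>)
  qed
  ultimately have "vn_entropy \<rho> = - (\<Sum>s<a * b. Re (T $$ (s, s)) * log 2 (Re (T $$ (s, s))))"
    using carr by (intro vn_entropy_triangular)
  also have "\<dots> = - (\<Sum>k<a. \<Sum>y<b. Re (B k $$ (y, y)) * log 2 (Re (B k $$ (y, y))))"
    by (auto simp: sum_lessThan_mult_split T_def mult_add_less intro!: sum.cong)
  also have "\<dots> = (\<Sum>k<a. vn_entropy (R (e k)))"
    unfolding sum_negf[of _ "{..<a}", symmetric]
  proof (intro sum.cong refl vn_entropy_triangular[symmetric])
    fix k assume "k \<in> {..<a}"
    then have k: "k < a" by simp
    show "similar_mat (R (e k)) (B k)" using wit[OF k] by (auto simp: similar_mat_def)
    show "B k \<in> carrier_mat b b" using w(5) k by simp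
    show "upper_triangular (B k)" by (rule ut[OF k])
  qed
  also have "\<dots> = (\<Sum>i\<in>I. vn_entropy (R i))"
    by (rule sum.reindex_bij_betw[OF e])
  finally show ?thesis by (simp add: \<rho>_def a_def)
qed

section \<open>Measuring the second factor in its computational basis\<close>

lemma proj_snd_index:
  assumes "y < b" "s < a * b" "t < a * b"
  shows "proj_snd a b y $$ (s, t) = (if s = t \<and> s mod b = y then 1 else 0)"
proof -
  have "s = t \<longleftrightarrow> s div b = t div b \<and> s mod b = t mod b"
    by (metis div_mult_mod_eq)
  then show ?thesis
    using assms by (auto simp: proj_snd_def kron_def ketbra_def less_mult_imp_div_less)
qed

lemma proj_snd_carrier: "proj_snd a b y \<in> carrier_mat (a * b) (a * b)"
  by (simp add: proj_snd_def kron_def ketbra_def)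

text \<open>The projector is a diagonal matrix of zeros and ones: from the left it selects rows,
  from the right columns, namely those whose second coordinate is \<open>y\<close>.\<close>

lemma proj_snd_sandwich:
  assumes y: "y < b" and \<rho>: "\<rho> \<in> carrier_mat (a * b) (a * b)"
  shows "proj_snd a b y * \<rho> * proj_snd a b y
    = mat (a * b) (a * b) (\<lambda>(s, t). if s mod b = y \<and> t mod b = y then \<rho> $$ (s, t) else 0)"
proof (rule eq_matI)
  let ?P = "proj_snd a b y"
  note c = proj_snd_carrier[of a b y]
  have P\<rho>: "(?P * \<rho>) $$ (s, t) = (if s mod b = y then \<rho> $$ (s, t) else 0)"
    if "s < a * b" "t < a * b" for s t
  proof -
    have "(?P * \<rho>) $$ (s, t) = (\<Sum>r<a * b. ?P $$ (s, r) * \<rho> $$ (r, t))"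
      using that by (intro mult_mat_index c \<rho>)
    also have "\<dots> = (\<Sum>r<a * b. if s = r then (if s mod b = y then \<rho> $$ (s, t) else 0) else 0)"
      using that y by (intro sum.cong refl) (auto simp: proj_snd_index)
    finally show ?thesis using that by simp
  qed
  let ?M = "mat (a * b) (a * b) (\<lambda>(s, t). if s mod b = y \<and> t mod b = y then \<rho> $$ (s, t) else 0)"
  fix s t assume "s < dim_row ?M" "t < dim_col ?M"
  then have st: "s < a * b" "t < a * b" by auto
  have "(?P * \<rho> * ?P) $$ (s, t) = (\<Sum>r<a * b. (?P * \<rho>) $$ (s, r) * ?P $$ (r, t))"
    using st by (intro mult_mat_index mult_carrier_mat[OF c \<rho>] c)
  also have "\<dots> = (\<Sum>r<a * b. if r = t then (if s mod b = y \<and> t mod b = y then \<rho> $$ (s, t) else 0) else 0)"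
    using st y by (intro sum.cong refl) (auto simp: proj_snd_index P\<rho> simp del: index_mult_mat(1))
  finally show "(?P * \<rho> * ?P) $$ (s, t) = ?M $$ (s, t)"
    using st by simp
qed (use \<rho> proj_snd_carrier[of a b y] in auto)

lemma outcome_prob_eq:
  assumes "y < b" "\<rho> \<in> carrier_mat (a * b) (a * b)"
  shows "outcome_prob a b \<rho> y = (\<Sum>i<a. Re (\<rho> $$ (i * b + y, i * b + y)))"
proof -
  have "outcome_prob a b \<rho> y
    = (\<Sum>i<a. \<Sum>u<b. if u = y then Re (\<rho> $$ (i * b + y, i * b + y)) else 0)"
    using assms
    by (auto simp: outcome_prob_def proj_snd_sandwich mtrace_def sum_lessThan_mult_split mult_add_less
        intro!: sum.cong)
  then show ?thesis using assms by simp
qed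

lemma cond_state_eq:
  assumes "y < b" "\<rho> \<in> carrier_mat (a * b) (a * b)"
  shows "cond_state a b \<rho> y = mat a a
    (\<lambda>(i, k). complex_of_real (1 / outcome_prob a b \<rho> y) * \<rho> $$ (i * b + y, k * b + y))"
proof -
  have "(\<Sum>u<b. (proj_snd a b y * \<rho> * proj_snd a b y) $$ (i * b + u, k * b + u))
    = \<rho> $$ (i * b + y, k * b + y)" if "i < a" "k < a" for i k
  proof -
    have "(\<Sum>u<b. (proj_snd a b y * \<rho> * proj_snd a b y) $$ (i * b + u, k * b + u))
      = (\<Sum>u<b. if u = y then \<rho> $$ (i * b + y, k * b + y) else 0)"
      using assms that by (auto simp: proj_snd_sandwich mult_add_less intro!: sum.cong)
    then show ?thesis using assms by simp
  qed
  then show ?thesis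
    by (intro eq_matI) (auto simp: cond_state_def ptrace_snd_def simp del: index_mult_mat)
qed

section \<open>Marginals and conditional states of a classical-quantum state\<close>

lemma vn_entropy_one_dim: "vn_entropy (mat 1 1 (\<lambda>_. c)) = - (Re c * log 2 (Re c))"
  by (subst vn_entropy_triangular[of _ "mat 1 1 (\<lambda>_. c)" 1])
    (auto simp: upper_triangular_def intro: similar_mat_refl[of _ 1])

text \<open>The blocks \<open>R i\<close> stand for the subnormalised states p_i sigma_i. There are
  as many kets as dimensions, so they form an orthonormal basis of the first factor.\<close>

locale cq_state =
  fixes I :: "'i set" and ket :: "'i \<Rightarrow> complex vec" and R :: "'i \<Rightarrow> complex mat" and b :: nat
    and \<rho> :: "complex mat"
  assumes finite_I: "finite I"
    and ket_carrier: "\<And>i. i \<in> I \<Longrightarrow> ket i \<in> carrier_vec (card I)"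
    and ket_orthonormal: "\<And>i j. i \<in> I \<Longrightarrow> j \<in> I \<Longrightarrow> ket i \<bullet>c ket j = (if i = j then 1 else 0)"
    and R_carrier: "\<And>i. i \<in> I \<Longrightarrow> R i \<in> carrier_mat b b"
    and \<rho>_def: "\<rho> = mat_sum (card I * b) (\<lambda>i. kron (ketbra (ket i)) (R i)) I"
begin

lemma carrier: "\<rho> \<in> carrier_mat (card I * b) (card I * b)"
  by (simp add: \<rho>_def mat_sum_def)

lemma index:
  assumes "i < card I" "y < b" "k < card I" "z < b"
  shows "\<rho> $$ (i * b + y, k * b + z) = (\<Sum>j\<in>I. ket j $ i * cnj (ket j $ k) * R j $$ (y, z))"
  using assms carrier_vecD[OF ket_carrier] carrier_matD[OF R_carrier]
  by (auto simp: \<rho>_def mat_sum_def kron_def ketbra_def mult_add_less intro!: sum.cong)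

text \<open>Tracing out the first factor turns each ket-bra into the squared norm of its ket, which
  is 1. General \<open>y\<close>, \<open>z\<close> give the reduced state, \<open>y = z\<close> the
  outcome probabilities.\<close>

lemma sum_diagonal_blocks:
  assumes "y < b" "z < b"
  shows "(\<Sum>i<card I. \<rho> $$ (i * b + y, i * b + z)) = (\<Sum>j\<in>I. R j $$ (y, z))"
proof -
  have "(\<Sum>i<card I. \<rho> $$ (i * b + y, i * b + z))
    = (\<Sum>j\<in>I. \<Sum>i<card I. ket j $ i * cnj (ket j $ i) * R j $$ (y, z))"
    using assms by (subst sum.swap) (auto simp: index intro!: sum.cong)
  also have "\<dots> = (\<Sum>j\<in>I. (ket j \<bullet>c ket j) * R j $$ (y, z))"
    using sum_cnj_conv_cscalar_prod[OF ket_carrier ket_carrier]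
    by (auto simp flip: sum_distrib_right intro!: sum.cong)
  finally show ?thesis using ket_orthonormal by simp
qed

lemma ptrace_fst_eq: "ptrace_fst (card I) b \<rho> = mat_sum b R I"
  by (intro eq_matI) (auto simp: ptrace_fst_def mat_sum_def sum_diagonal_blocks)

lemma outcome_prob_cq:
  assumes "y < b"
  shows "outcome_prob (card I) b \<rho> y = (\<Sum>j\<in>I. Re (R j $$ (y, y)))"
  using assms sum_diagonal_blocks[OF assms assms]
  by (simp add: outcome_prob_eq carrier flip: Re_sum)

text \<open>Given the outcome, the state is diagonal in the ket basis with weights whose real parts
  are the \<open>q j\<close>; its entropy is therefore the Shannon entropy of the conditional law of
  the label.\<close>

lemma vn_entropy_cond_state:
  assumes y: "y < b"
  defines "q \<equiv> \<lambda>j. Re (R j $$ (y, y)) / outcome_prob (card I) b \<rho> y"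
  shows "vn_entropy (cond_state (card I) b \<rho> y) = - (\<Sum>j\<in>I. q j * log 2 (q j))"
proof -
  define c where "c j = complex_of_real (1 / outcome_prob (card I) b \<rho> y) * R j $$ (y, y)" for j
  \<comment> \<open>The conditional state is itself a classical-quantum sum with a one-dimensional
    second factor; the dimension \<open>card I * 1\<close> lets \<open>vn_entropy_block\<close>
    apply with 1 by 1 blocks.\<close>
  have "cond_state (card I) b \<rho> y
    = mat_sum (card I * 1) (\<lambda>j. kron (ketbra (ket j)) (mat 1 1 (\<lambda>_. c j))) I"
    unfolding cond_state_eq[OF y carrier]
    using y carrier_vecD[OF ket_carrier]
    by (intro eq_matI)
      (auto simp: index mat_sum_def kron_def ketbra_def c_def
        sum_divide_distrib mult.assoc intro!: sum.cong)
  also have "vn_entropy \<dots> = (\<Sum>j\<in>I. vn_entropy (mat 1 1 (\<lambda>_. c j)))"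
    using finite_I ket_carrier ket_orthonormal by (intro vn_entropy_block) auto
  finally show ?thesis
    by (simp add: vn_entropy_one_dim c_def q_def sum_negf del: One_nat_def)
qed

end

section \<open>Mutual information of random variables with finitely many values\<close>

lemma (in prob_space) distributed_count_space_finite:
  assumes "finite A" and X: "X \<in> measurable M (count_space A)"
  shows "distributed M (count_space A) X (\<lambda>x. ennreal (\<P>(\<omega> in M. X \<omega> = x)))"
proof -
  have "distr M (count_space A) X = density (count_space A) (\<lambda>x. ennreal (\<P>(\<omega> in M. X \<omega> = x)))"
  proof (rule measure_eqI_finite[of _ A])
    fix x assume x: "x \<in> A"
    have "{\<omega> \<in> space M. X \<omega> = x} = X -` {x} \<inter> space M" by auto
    then show "emeasure (distr M (count_space A) X) {x}
      = emeasure (density (count_space A) (\<lambda>x. ennreal (\<P>(\<omega> in M. X \<omega> = x)))) {x}"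
      using x X assms(1)
      by (simp add: emeasure_distr emeasure_density nn_integral_count_space_finite emeasure_eq_measure
          indicator_def if_distrib sum.If_cases mult_ac cong: if_cong)
  qed (use assms in auto)
  then show ?thesis using X by (simp add: distributed_def)
qed

text \<open>The product of two finite counting measures is again a counting measure, and point
  masses are densities with respect to it, so the integral formula for mutual information becomes a
  finite double sum.\<close>

lemma (in information_space) mutual_information_count_space_finite:
  assumes fin: "finite A" "finite B"
    and X: "X \<in> measurable M (count_space A)" and Y: "Y \<in> measurable M (count_space B)"
  shows "mutual_information b (count_space A) (count_space B) X Y
    = (\<Sum>x\<in>A. \<Sum>y\<in>B. \<P>(\<omega> in M. X \<omega> = x \<and> Y \<omega> = y) *
        log b (\<P>(\<omega> in M. X \<omega> = x \<and> Y \<omega> = y) / (\<P>(\<omega> in M. X \<omega> = x) * \<P>(\<omega> in M. Y \<omega> = y))))"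
proof -
  have prod: "count_space A \<Otimes>\<^sub>M count_space B = count_space (A \<times> B)"
    using fin by (simp add: pair_measure_count_space)
  have XY: "(\<lambda>\<omega>. (X \<omega>, Y \<omega>)) \<in> measurable M (count_space (A \<times> B))"
    using measurable_Pair[OF X Y] by (simp add: prod)
  note sf = sigma_finite_measure_count_space_finite
  have D: "distributed M (count_space A \<Otimes>\<^sub>M count_space B) (\<lambda>\<omega>. (X \<omega>, Y \<omega>))
      (\<lambda>z. ennreal (\<P>(\<omega> in M. (X \<omega>, Y \<omega>) = z)))"
    unfolding prod using fin XY by (intro distributed_count_space_finite) auto
  show ?thesis
    by (subst mutual_information_distr[OF sf[OF fin(1)] sf[OF fin(2)]
          distributed_count_space_finite[OF fin(1) X] _ distributed_count_space_finite[OF fin(2) Y] _ D])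
      (use fin in \<open>auto simp: prod lebesgue_integral_count_space_finite sum.cartesian_product split_beta prod_eq_iff\<close>)
qed

section \<open>The discord of the oracle state\<close>

lemma cscalar_unit_vec_eq_index:
  assumes "A \<in> carrier_mat d d" "y < d"
  shows "(A *\<^sub>v unit_vec d y) \<bullet>c (unit_vec d y :: complex vec) = A $$ (y, y)"
proof -
  have "(A *\<^sub>v unit_vec d y) \<bullet>c unit_vec d y = (\<Sum>i<d. if i = y then A $$ (i, y) else 0)"
    using assms unfolding scalar_prod_def dim_vec_conjugate index_unit_vec(3) atLeast0LessThan
    by (intro sum.cong refl) auto
  then show ?thesis using assms by simp
qed

theorem mainTheorem2:
  fixes n m :: nat
    and V W :: "complex mat" and \<psi>\<^sub>0 :: "complex vec"
    and \<F> :: "'f set" and \<J> :: "'j set" and A :: "'j \<Rightarrow> 'f set"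
    and U :: "'f \<Rightarrow> complex mat" and p :: "'f \<Rightarrow> real"
    and ket :: "'j \<Rightarrow> complex vec"
    and pJ :: "'j \<Rightarrow> real" and \<sigma> :: "'j \<Rightarrow> complex mat"
    and \<rho>\<^sub>Y \<rho>\<^sub>J\<^sub>Y :: "complex mat"
    and M :: "'w measure" and F :: "'w \<Rightarrow> 'f" and J :: "'w \<Rightarrow> 'j" and Y :: "'w \<Rightarrow> nat"
  assumes finite_F: "finite \<F>"
    and partition: "disjoint_family_on A \<J>" "(\<Union>j\<in>\<J>. A j) = \<F>" "\<And>j. j \<in> \<J> \<Longrightarrow> A j \<noteq> {}"
    and m_le_n: "m \<le> n"
    and oracle_unitary: "\<And>f. f \<in> \<F> \<Longrightarrow> unitary_mat (2 ^ m) (U f)"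
    and p_distr: "\<And>f. f \<in> \<F> \<Longrightarrow> p f \<ge> 0" "(\<Sum>f\<in>\<F>. p f) = 1"
    and pJ: "\<And>j. j \<in> \<J> \<Longrightarrow> pJ j = (\<Sum>f\<in>A j. p f)"
    and pJ_pos: "\<And>j. j \<in> \<J> \<Longrightarrow> pJ j > 0"
    and V: "unitary_mat (2 ^ n) V" and W: "unitary_mat (2 ^ n) W"
    and \<psi>\<^sub>0: "\<psi>\<^sub>0 \<in> carrier_vec (2 ^ n)" "\<psi>\<^sub>0 \<bullet>c \<psi>\<^sub>0 = 1"
    and \<sigma>: "\<And>j. j \<in> \<J> \<Longrightarrow> \<sigma> j = class_state n p (\<lambda>f. query_op n m V W (U f)) \<psi>\<^sub>0 (A j)"
    and ket: "\<And>j. j \<in> \<J> \<Longrightarrow> ket j \<in> carrier_vec (card \<J>)"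
      "\<And>i j. i \<in> \<J> \<Longrightarrow> j \<in> \<J> \<Longrightarrow> ket i \<bullet>c ket j = (if i = j then 1 else 0)"
    and \<rho>\<^sub>Y: "\<rho>\<^sub>Y = mat_sum (2 ^ n) (\<lambda>j. complex_of_real (pJ j) \<cdot>\<^sub>m \<sigma> j) \<J>"
    and \<rho>\<^sub>J\<^sub>Y: "\<rho>\<^sub>J\<^sub>Y = mat_sum (card \<J> * 2 ^ n)
       (\<lambda>j. complex_of_real (pJ j) \<cdot>\<^sub>m kron (ketbra (ket j)) (\<sigma> j)) \<J>"
    and M: "prob_space M"
    and F: "F \<in> measurable M (count_space \<F>)"
      "\<And>f. f \<in> \<F> \<Longrightarrow> \<P>(\<omega> in M. F \<omega> = f) = p f"
    and J: "\<And>\<omega>. \<omega> \<in> space M \<Longrightarrow> J \<omega> \<in> \<J> \<and> F \<omega> \<in> A (J \<omega>)"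
    and Y: "Y \<in> measurable M (count_space {..<2 ^ n})"
      "\<And>j y. j \<in> \<J> \<Longrightarrow> y < 2 ^ n \<Longrightarrow>
         complex_of_real (\<P>(\<omega> in M. Y \<omega> = y \<bar> J \<omega> = j))
           = (\<sigma> j *\<^sub>v unit_vec (2 ^ n) y) \<bullet>c unit_vec (2 ^ n) y"
  shows "discord_comp (card \<J>) (2 ^ n) \<rho>\<^sub>J\<^sub>Y
    = (vn_entropy \<rho>\<^sub>Y - (\<Sum>j\<in>\<J>. pJ j * vn_entropy (\<sigma> j)))
      - prob_space.mutual_information M 2 (count_space \<J>) (count_space {..<2 ^ n}) J Y"
proof -
  interpret information_space M 2
    using M by (simp add: information_space_def information_space_axioms_def)
  \<comment> \<open>The classes are nonempty and disjoint, so choosing a representative of each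
    embeds \<open>\<J>\<close> into the finite set \<open>\<F>\<close>.\<close>
  have fin_J: "finite \<J>"
  proof -
    obtain g where g: "\<And>j. j \<in> \<J> \<Longrightarrow> g j \<in> A j"
      using bchoice[of \<J> "\<lambda>j f. f \<in> A j"] partition(3) by blast
    have "inj_on g \<J>"
      using g partition(1) by (fastforce simp: inj_on_def disjoint_family_on_def)
    moreover have "g ` \<J> \<subseteq> \<F>" using g partition(2) by auto
    ultimately show ?thesis using finite_F by (meson finite_imageD finite_subset)
  qed
  \<comment> \<open>\<open>F \<omega>\<close> lies in exactly one class, so events about
    \<open>J\<close> are finite unions of events about \<open>F\<close>; measurability and law of
    \<open>J\<close> are inherited from \<open>F\<close>.\<close>
  have J_eq: "{\<omega> \<in> space M. J \<omega> = j} = (\<Union>f\<in>A j. {\<omega> \<in> space M. F \<omega> = f})" if "j \<in> \<J>" for j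
    using J that partition(1) by (fastforce simp: disjoint_family_on_def)
  have A_sub: "A j \<subseteq> \<F>" if "j \<in> \<J>" for j using partition(2) that by auto
  have fin_A: "finite (A j)" if "j \<in> \<J>" for j
    using A_sub[OF that] finite_F by (rule finite_subset)
  have F_ev: "{\<omega> \<in> space M. F \<omega> = f} \<in> events" if "f \<in> \<F>" for f
  proof -
    have "{\<omega> \<in> space M. F \<omega> = f} = F -` {f} \<inter> space M" by auto
    then show ?thesis using F(1) that by (simp add: measurable_sets)
  qed
  have J_ev: "{\<omega> \<in> space M. J \<omega> = j} \<in> events" if "j \<in> \<J>" for j
    unfolding J_eq[OF that] using fin_A[OF that] F_ev A_sub[OF that] by auto
  have J_meas: "J \<in> measurable M (count_space \<J>)"
    using J J_ev fin_J
    by (intro measurable_count_space_eq2[THEN iffD2])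
      (auto simp: vimage_def Int_def conj_commute)
  have Y_ev: "{\<omega> \<in> space M. Y \<omega> = y} \<in> events" if "y < 2 ^ n" for y
  proof -
    have "{\<omega> \<in> space M. Y \<omega> = y} = Y -` {y} \<inter> space M" by auto
    then show ?thesis using Y(1) that by (simp add: measurable_sets)
  qed
  have prob_J: "\<P>(\<omega> in M. J \<omega> = j) = pJ j" if j: "j \<in> \<J>" for j
  proof -
    have "prob (\<Union>f\<in>A j. {\<omega> \<in> space M. F \<omega> = f}) = (\<Sum>f\<in>A j. \<P>(\<omega> in M. F \<omega> = f))"
      using fin_A[OF j] F_ev A_sub[OF j]
      by (intro finite_measure_finite_Union) (auto simp: disjoint_family_on_def)
    also have "\<dots> = pJ j" using F(2) A_sub[OF j] pJ[OF j] by (auto intro!: sum.cong)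
    finally show ?thesis by (simp add: J_eq[OF j])
  qed

  \<comment> \<open>\<open>q\<close> is the joint law of (J, Y) and \<open>r\<close> the law of Y.
    Apart from S(rho_Y) and the S(sigma_j), every quantity below becomes a double sum weighted by
    \<open>q\<close>.\<close>
  define q where "q j y = \<P>(\<omega> in M. J \<omega> = j \<and> Y \<omega> = y)" for j y
  define r where "r y = \<P>(\<omega> in M. Y \<omega> = y)" for y
  have q_eq: "q j y = pJ j * \<P>(\<omega> in M. Y \<omega> = y \<bar> J \<omega> = j)" if "j \<in> \<J>" for j y
  proof -
    have "{\<omega> \<in> space M. Y \<omega> = y \<and> J \<omega> = j} = {\<omega> \<in> space M. J \<omega> = j \<and> Y \<omega> = y}" by auto
    then show ?thesis using pJ_pos[OF that] by (simp add: cond_prob_def prob_J[OF that] q_def)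
  qed
  have q_ev: "{\<omega> \<in> space M. J \<omega> = j \<and> Y \<omega> = y} \<in> events" if "j \<in> \<J>" "y < 2 ^ n" for j y
    using J_ev Y_ev that by (intro sets.sets_Collect_conj) auto
  have sum_q_J: "(\<Sum>j\<in>\<J>. q j y) = r y" if y: "y < 2 ^ n" for y
  proof -
    have "r y = prob (\<Union>j\<in>\<J>. {\<omega> \<in> space M. J \<omega> = j \<and> Y \<omega> = y})"
      unfolding r_def using J by (intro arg_cong[of _ _ prob]) auto
    also have "\<dots> = (\<Sum>j\<in>\<J>. q j y)"
      unfolding q_def using fin_J q_ev y
      by (intro finite_measure_finite_Union) (auto simp: disjoint_family_on_def)
    finally show ?thesis ..
  qed
  have sum_q_Y: "(\<Sum>y<2 ^ n. q j y) = pJ j" if j: "j \<in> \<J>" for j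
  proof -
    have "Y \<omega> < 2 ^ n" if "\<omega> \<in> space M" for \<omega>
      using measurable_space[OF Y(1) that] by simp
    then have "pJ j = prob (\<Union>y<2 ^ n. {\<omega> \<in> space M. J \<omega> = j \<and> Y \<omega> = y})"
      unfolding prob_J[OF j, symmetric] by (intro arg_cong[of _ _ prob]) auto
    also have "\<dots> = (\<Sum>y<2 ^ n. q j y)"
      unfolding q_def using q_ev j
      by (intro finite_measure_finite_Union) (auto simp: disjoint_family_on_def)
    finally show ?thesis ..
  qed
  \<comment> \<open>The joint probabilities are nonnegative and sum to \<open>r y\<close>. This
    disposes of every division by \<open>r y = 0\<close> below.\<close>
  have q_zero: "q j y = 0" if "j \<in> \<J>" "y < 2 ^ n" "r y = 0" for j y
    using sum_q_J[OF that(2)] that fin_J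
    by (simp add: sum_nonneg_eq_0_iff q_def)

  define R where "R j = complex_of_real (pJ j) \<cdot>\<^sub>m \<sigma> j" for j
  have \<sigma>_carrier: "\<sigma> j \<in> carrier_mat (2 ^ n) (2 ^ n)" if "j \<in> \<J>" for j
    using \<sigma>[OF that] by (simp add: class_state_def mat_sum_def)
  have R_carrier: "R j \<in> carrier_mat (2 ^ n) (2 ^ n)" if "j \<in> \<J>" for j
    using \<sigma>_carrier[OF that] by (simp add: R_def)
  \<comment> \<open>The Born rule assumed for \<open>Y\<close> identifies the diagonal of
    \<open>\<sigma> j\<close> with conditional probabilities; multiplying by \<open>pJ j\<close>
    gives the joint law.\<close>
  have \<sigma>_diag: "pJ j * Re (\<sigma> j $$ (y, y)) = q j y" if "j \<in> \<J>" "y < 2 ^ n" for j y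
    using Y(2)[OF that] cscalar_unit_vec_eq_index[OF \<sigma>_carrier[OF that(1)] that(2)]
    by (metis Re_complex_of_real q_eq[OF that(1)])
  have R_diag: "Re (R j $$ (y, y)) = q j y" if "j \<in> \<J>" "y < 2 ^ n" for j y
    using \<sigma>_diag[OF that] \<sigma>_carrier[OF that(1)] that(2) by (simp add: R_def)
  \<comment> \<open>The normalisation comes from the measurement statistics: summing the weighted
    diagonal over all outcomes gives back \<open>pJ j\<close>.\<close>
  have tr_\<sigma>: "Re (mtrace (\<sigma> j)) = 1" if j: "j \<in> \<J>" for j
  proof -
    have "pJ j * Re (mtrace (\<sigma> j)) = pJ j"
      using \<sigma>_carrier[OF j] \<sigma>_diag[OF j] sum_q_Y[OF j]
      by (simp add: mtrace_def sum_distrib_left)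
    then show ?thesis using pJ_pos[OF j] by simp
  qed

  interpret cq: cq_state \<J> ket R "2 ^ n" \<rho>\<^sub>J\<^sub>Y
  proof
    have "complex_of_real (pJ j) \<cdot>\<^sub>m kron K (\<sigma> j) = kron K (R j)" if "j \<in> \<J>" for j K
      using \<sigma>_carrier[OF that]
      by (intro eq_matI) (auto simp: kron_def R_def mod_less_divisor)
    then show "\<rho>\<^sub>J\<^sub>Y = mat_sum (card \<J> * 2 ^ n) (\<lambda>j. kron (ketbra (ket j)) (R j)) \<J>"
      unfolding \<rho>\<^sub>J\<^sub>Y mat_sum_def by (intro arg_cong[of _ _ "mat _ _"] ext sum.cong) auto
  qed (use fin_J ket R_carrier in auto)

  have S_Y: "ptrace_fst (card \<J>) (2 ^ n) \<rho>\<^sub>J\<^sub>Y = \<rho>\<^sub>Y"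
    unfolding cq.ptrace_fst_eq \<rho>\<^sub>Y R_def ..
  have "vn_entropy \<rho>\<^sub>J\<^sub>Y = (\<Sum>j\<in>\<J>. vn_entropy (R j))"
    unfolding cq.\<rho>_def using fin_J ket R_carrier by (intro vn_entropy_block) auto
  also have "\<dots> = (\<Sum>j\<in>\<J>. pJ j * vn_entropy (\<sigma> j) - pJ j * log 2 (pJ j))"
    unfolding R_def using vn_entropy_smult[OF \<sigma>_carrier pJ_pos] tr_\<sigma> by simp
  \<comment> \<open>\<open>pJ j\<close> is expanded as the sum of \<open>q j y\<close> over
    \<open>y\<close>, giving H(J) the same double-sum shape as H(J | Y) and I(J;Y).\<close>
  also have "\<dots> = (\<Sum>j\<in>\<J>. pJ j * vn_entropy (\<sigma> j)) - (\<Sum>j\<in>\<J>. \<Sum>y<2 ^ n. q j y * log 2 (pJ j))"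
    using sum_q_Y by (simp add: sum_subtractf flip: sum_distrib_right)
  finally have S_JY: "vn_entropy \<rho>\<^sub>J\<^sub>Y = (\<Sum>j\<in>\<J>. pJ j * vn_entropy (\<sigma> j))
    - (\<Sum>j\<in>\<J>. \<Sum>y<2 ^ n. q j y * log 2 (pJ j))" .

  have out: "outcome_prob (card \<J>) (2 ^ n) \<rho>\<^sub>J\<^sub>Y y = r y" if "y < 2 ^ n" for y
    using that sum_q_J[OF that] by (simp add: cq.outcome_prob_cq R_diag)
  have "cond_entropy (card \<J>) (2 ^ n) \<rho>\<^sub>J\<^sub>Y
    = (\<Sum>y | y < 2 ^ n \<and> r y \<noteq> 0. r y * - (\<Sum>j\<in>\<J>. q j y / r y * log 2 (q j y / r y)))"
    unfolding cond_entropy_def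
    by (intro sum.cong) (auto simp: cq.vn_entropy_cond_state out R_diag)
  also have "\<dots> = (\<Sum>y | y < 2 ^ n \<and> r y \<noteq> 0. - (\<Sum>j\<in>\<J>. q j y * log 2 (q j y / r y)))"
    by (intro sum.cong refl) (auto simp: sum_distrib_left)
  \<comment> \<open>The outcomes of probability zero are put back in; all their terms vanish by
    \<open>q_zero\<close>.\<close>
  also have "\<dots> = (\<Sum>y<2 ^ n. - (\<Sum>j\<in>\<J>. q j y * log 2 (q j y / r y)))"
    by (intro sum.mono_neutral_left) (auto simp: q_zero)
  also have "\<dots> = - (\<Sum>j\<in>\<J>. \<Sum>y<2 ^ n. q j y * log 2 (q j y / r y))"
    by (subst sum.swap) (simp add: sum_negf)
  finally have cond: "cond_entropy (card \<J>) (2 ^ n) \<rho>\<^sub>J\<^sub>Y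
    = - (\<Sum>j\<in>\<J>. \<Sum>y<2 ^ n. q j y * log 2 (q j y / r y))" .

  have "mutual_information 2 (count_space \<J>) (count_space {..<2 ^ n}) J Y
    = (\<Sum>j\<in>\<J>. \<Sum>y<2 ^ n. q j y * log 2 (q j y / (pJ j * r y)))"
    by (simp add: mutual_information_count_space_finite[OF fin_J _ J_meas Y(1)] prob_J q_def r_def)
  \<comment> \<open>If \<open>q j y = 0\<close>, both sides are zero. Otherwise \<open>r y\<close>
    is nonzero by \<open>q_zero\<close> and \<open>pJ j\<close> is positive, so the logarithm
    splits; this is I(J;Y) = H(J) - H(J | Y) term by term.\<close>
  also have "\<dots> = (\<Sum>j\<in>\<J>. \<Sum>y<2 ^ n. q j y * log 2 (q j y / r y) - q j y * log 2 (pJ j))"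
  proof (intro sum.cong refl)
    fix j y assume h: "j \<in> \<J>" "y \<in> {..<2 ^ n :: nat}"
    then show "q j y * log 2 (q j y / (pJ j * r y))
      = q j y * log 2 (q j y / r y) - q j y * log 2 (pJ j)"
      using q_zero[of j y] pJ_pos[of j] by (auto simp: log_divide log_mult algebra_simps)
  qed
  also have "\<dots> = (\<Sum>j\<in>\<J>. \<Sum>y<2 ^ n. q j y * log 2 (q j y / r y))
    - (\<Sum>j\<in>\<J>. \<Sum>y<2 ^ n. q j y * log 2 (pJ j))"
    by (simp add: sum_subtractf)
  finally show ?thesis
    unfolding discord_comp_def S_Y S_JY cond by simp
qed

end
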